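(* Let $L$ be a denumerable (countably infinite) set (a language) and let $f\colon\mathbb{N}\to L$ be a bijection, where $0\in\mathbb{N}$. For each $n\geq 1$ let $B_n=\{f(1),\ldots,f(n)\}$ and let $C_n=C'(\{f(0)\},B_n)$. Then each $C_n$ is a finite consequence operator on $\mathcal{P}(L)$, but $\bigwedge\{C_n\mid n\geq 1\}$, the infimum of the $C_n$ in the lattice of all general consequence operators on $\mathcal{P}(L)$, is not a finite consequence operator. In this sense the lattice of finite consequence operators on $\mathcal{P}(L)$ is not meet-complete.
   Context: $\mathcal{P}(L)$ is the power set of $L$ and $\mathcal{F}(X)$ is the set of all finite subsets of $X$. A general consequence operator on $\mathcal{P}(L)$ is a map $C\colon\mathcal{P}(L)\to\mathcal{P}(L)$ such that for all $X,Y\subset L$: (1) $X\subset C(X)=C(C(X))$; (2) if $X\subset Y$, then $C(X)\subset C(Y)$. It is a finite consequence operator if, in addition, $C(X)=\bigcup\{C(F)\mid F\in\mathcal{F}(X)\}$ for all $X\subset L$. General consequence operators are ordered by $C_1\leq C_2$ iff $C_1(X)\subset C_2(X)$ for all $X\subset L$; the infimum of a nonempty set $\mathcal{H}$ of them is given by $(\bigwedge\mathcal{H})(X)=\bigcap\{C(X)\mid C\in\mathcal{H}\}$. For $X,Y\subset L$ the map $C'(X,Y)\colon\mathcal{P}(L)\to\mathcal{P}(L)$ is defined by $C'(X,Y)(A)=A\cup X$ if $Y\subset A$, and $C'(X,Y)(A)=A$ if $Y\not\subset A$. *)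

theory Defs
  imports "HOL-Algebra.Order" "HOL-Library.Countable_Set"
begin

text \<open>
  The language is a carrier set \<open>L\<close>. Maps from the power set of \<open>L\<close> to itself are extensional
  functions (\<open>undefined\<close> outside \<open>Pow L\<close>), so that equality of operators is equality on
  the subsets of \<open>L\<close> and the pointwise order is antisymmetric.
\<close>

definition general_cons_ops :: "'a set \<Rightarrow> ('a set \<Rightarrow> 'a set) set" where
  "general_cons_ops L = {C \<in> Pow L \<rightarrow>\<^sub>E Pow L.
     (\<forall>X \<in> Pow L. X \<subseteq> C X \<and> C X = C (C X)) \<and>
     (\<forall>X \<in> Pow L. \<forall>Y \<in> Pow L. X \<subseteq> Y \<longrightarrow> C X \<subseteq> C Y)}"

definition finite_cons_ops :: "'a set \<Rightarrow> ('a set \<Rightarrow> 'a set) set" where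
  "finite_cons_ops L = {C \<in> general_cons_ops L. \<forall>X \<in> Pow L. C X = (\<Union>F \<in> Fpow X. C F)}"

definition general_cons_order :: "'a set \<Rightarrow> ('a set \<Rightarrow> 'a set) gorder" where
  "general_cons_order L =
     \<lparr>carrier = general_cons_ops L, eq = (=), le = (\<lambda>C D. \<forall>X \<in> Pow L. C X \<subseteq> D X)\<rparr>"

text \<open>Intended for nonempty \<open>\<H>\<close> only: for \<open>\<H> = {}\<close> the intersection is \<open>UNIV\<close>, not \<open>L\<close>.\<close>

definition cons_Inf :: "'a set \<Rightarrow> ('a set \<Rightarrow> 'a set) set \<Rightarrow> ('a set \<Rightarrow> 'a set)" where
  "cons_Inf L \<H> = (\<lambda>X \<in> Pow L. \<Inter>C \<in> \<H>. C X)"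

definition adjoin_if :: "'a set \<Rightarrow> 'a set \<Rightarrow> 'a set \<Rightarrow> ('a set \<Rightarrow> 'a set)" where
  "adjoin_if L X Y = (\<lambda>A \<in> Pow L. if Y \<subseteq> A then A \<union> X else A)"

end

(* On the infinite set f ` {1..} every C n adjoins f 0, whereas a finite subset of it fails to
   contain some B n, so the infimum of the C n adds f 0 to the former but not to the latter. *)
theory Submission
  imports Defs
begin

text \<open>Each \<open>C n\<close> adds the single conclusion \<open>f 0\<close> on the strength of
  the finite premise set \<open>B n\<close>, so it is finitary: whatever it derives from A it
  already derives from a singleton of A or from \<open>B n\<close>
  (\<open>adjoin_if_finite\<close>). By injectivity of \<open>f\<close> this premise set is infinite
  and omits \<open>f 0\<close>, and no finite subset of it can trigger the conclusion. The family of
  all \<open>C n\<close> thus refutes closure of the finite operators under infima.\<close>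

lemma general_cons_opsD:
  assumes "C \<in> general_cons_ops L" and "X \<subseteq> L"
  shows "C X \<subseteq> L" and "X \<subseteq> C X" and "C (C X) = C X"
    and "\<And>Y. Y \<subseteq> X \<Longrightarrow> C Y \<subseteq> C X"
proof -
  have X: "X \<in> Pow L" using assms(2) by (rule PowI)
  note C = assms(1)[unfolded general_cons_ops_def mem_Collect_eq]
  show "C X \<subseteq> L" using PiE_mem[OF conjunct1[OF C] X] by (rule PowD)
  have closure: "X \<subseteq> C X \<and> C X = C (C X)"
    by (rule bspec[OF conjunct1[OF conjunct2[OF C]] X])
  show "X \<subseteq> C X" by (rule conjunct1[OF closure])
  show "C (C X) = C X" by (rule conjunct2[OF closure, symmetric])
  show "C Y \<subseteq> C X" if "Y \<subseteq> X" for Y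
  proof -
    have "Y \<in> Pow L" using that assms(2) by blast
    from bspec[OF bspec[OF conjunct2[OF conjunct2[OF C]] this] X] that
    show ?thesis by (rule mp)
  qed
qed

text \<open>Idempotence: if the test Y \<subseteq> A succeeds, it succeeds again on A \<union> X,
  where adding X changes nothing; if it fails, A is left alone.\<close>

lemma adjoin_if_general:
  assumes "X \<subseteq> L"
  shows "adjoin_if L X Y \<in> general_cons_ops L"
  using assms unfolding general_cons_ops_def adjoin_if_def
  by (auto split: if_splits)

lemma adjoin_if_finite:
  assumes "X \<subseteq> L" and "finite Y"
  shows "adjoin_if L X Y \<in> finite_cons_ops L"
proof -
  let ?C = "adjoin_if L X Y"
  have gen: "?C \<in> general_cons_ops L"
    using assms(1) by (rule adjoin_if_general)
  have "?C A = (\<Union>F \<in> Fpow A. ?C F)" if A: "A \<subseteq> L" for A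
  proof
    show "(\<Union>F \<in> Fpow A. ?C F) \<subseteq> ?C A"
      using general_cons_opsD(4)[OF gen A] by (auto simp: Fpow_def)
    show "?C A \<subseteq> (\<Union>F \<in> Fpow A. ?C F)"
    proof
      fix a assume a: "a \<in> ?C A"
      show "a \<in> (\<Union>F \<in> Fpow A. ?C F)"
      proof (cases "a \<in> A")
        case True
        then have "{a} \<in> Fpow A" "a \<in> ?C {a}"
          using A general_cons_opsD(2)[OF gen, of "{a}"] by (auto simp: Fpow_def)
        then show ?thesis by blast
      next
        case False
        \<comment> \<open>A new element can only come from X, so the test succeeded on A; it also
          succeeds on Y itself, which is the finite set wanted.\<close>
        with a A have "a \<in> X" "Y \<subseteq> A"
          by (auto simp: adjoin_if_def split: if_splits)
        then have "Y \<in> Fpow A" "a \<in> ?C Y"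
          using A \<open>finite Y\<close> by (auto simp: Fpow_def adjoin_if_def)
        then show ?thesis by blast
      qed
    qed
  qed
  with gen show ?thesis by (simp add: finite_cons_ops_def)
qed

lemma cons_Inf_general:
  assumes "\<H> \<noteq> {}" and "\<H> \<subseteq> general_cons_ops L"
  shows "cons_Inf L \<H> \<in> general_cons_ops L"
proof -
  let ?D = "cons_Inf L \<H>"
  note D = general_cons_opsD[OF subsetD[OF assms(2)]]
  have eq: "?D X = (\<Inter>C \<in> \<H>. C X)" if "X \<subseteq> L" for X
    using that by (simp add: cons_Inf_def)
  have sub: "?D X \<subseteq> L" if "X \<subseteq> L" for X
  proof -
    \<comment> \<open>Nonemptiness supplies a member that bounds the intersection by L.\<close>
    obtain C where C: "C \<in> \<H>" using assms(1) by blast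
    then have "?D X \<subseteq> C X" using that by (auto simp: eq)
    then show ?thesis using D(1)[OF C that] by blast
  qed
  have ext: "X \<subseteq> ?D X" if "X \<subseteq> L" for X
    using D(2) that by (auto simp: eq)
  have mono: "?D X \<subseteq> ?D Y" if "Y \<subseteq> L" "X \<subseteq> Y" for X Y
  proof -
    have "X \<subseteq> L" using that by blast
    then have "?D X = (\<Inter>C \<in> \<H>. C X)" by (rule eq)
    also have "\<dots> \<subseteq> (\<Inter>C \<in> \<H>. C Y)"
      by (intro INF_mono) (use D(4)[OF _ that] in blast)
    also have "\<dots> = ?D Y" by (rule eq[OF that(1), symmetric])
    finally show ?thesis .
  qed
  have idem: "?D (?D X) \<subseteq> ?D X" if X: "X \<subseteq> L" for X
  proof -
    \<comment> \<open>Idempotence is checked against one member at a time: \<open>?D\<close> lies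
      below C, so monotonicity and idempotence of C absorb the second application.\<close>
    have "?D (?D X) \<subseteq> C X" if C: "C \<in> \<H>" for C
    proof -
      have "?D (?D X) \<subseteq> C (?D X)"
        unfolding eq[OF sub[OF X]] using C by blast
      also have "\<dots> \<subseteq> C (C X)"
        by (rule D(4)[OF C D(1)[OF C X]]) (use C in \<open>auto simp: eq[OF X]\<close>)
      also have "\<dots> = C X" by (rule D(3)[OF C X])
      finally show ?thesis .
    qed
    then show ?thesis unfolding eq[OF X] by (rule INF_greatest)
  qed
  have map: "?D \<in> Pow L \<rightarrow>\<^sub>E Pow L"
    using sub by (auto simp: cons_Inf_def)
  have fixed: "?D X = ?D (?D X)" if "X \<subseteq> L" for X
    by (rule equalityI[OF ext[OF sub[OF that]] idem[OF that]])
  show ?thesis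
    unfolding general_cons_ops_def
    by (intro CollectI conjI ballI impI map ext fixed mono) auto
qed

text \<open>Pointwise intersection is the largest pointwise lower bound; the substance is that it
  lies in the carrier, which is \<open>cons_Inf_general\<close>.\<close>

lemma cons_Inf_is_glb:
  assumes "\<H> \<noteq> {}" and "\<H> \<subseteq> general_cons_ops L"
  shows "is_glb (general_cons_order L) (cons_Inf L \<H>) \<H>"
proof -
  let ?G = "general_cons_order L" and ?D = "cons_Inf L \<H>"
  have le: "le ?G E F \<longleftrightarrow> (\<forall>X \<in> Pow L. E X \<subseteq> F X)" for E F
    by (simp add: general_cons_order_def)
  have "?D \<in> carrier ?G"
    using cons_Inf_general[OF assms] by (simp add: general_cons_order_def)
  moreover have "le ?G ?D E" if "E \<in> \<H>" for E
    using that by (auto simp: le cons_Inf_def)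
  moreover have "le ?G E ?D" if "\<forall>F \<in> \<H>. le ?G E F" for E
    using that by (fastforce simp: le cons_Inf_def)
  moreover have "\<H> \<subseteq> carrier ?G"
    using assms(2) by (simp add: general_cons_order_def)
  ultimately show ?thesis
    unfolding greatest_def Lower_def by blast
qed

theorem mainTheorem3:
  fixes L :: "'a set" and f :: "nat \<Rightarrow> 'a"
    and B :: "nat \<Rightarrow> 'a set" and C :: "nat \<Rightarrow> 'a set \<Rightarrow> 'a set"
  assumes "infinite L" and "countable L"
    and "bij_betw f UNIV L"
    and "\<And>n. n \<ge> 1 \<Longrightarrow> B n = f ` {1..n}"
    and "\<And>n. n \<ge> 1 \<Longrightarrow> C n = adjoin_if L {f 0} (B n)"
  shows "(\<forall>n\<ge>1. C n \<in> finite_cons_ops L) \<and>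
    is_glb (general_cons_order L) (cons_Inf L {C n | n. n \<ge> 1}) {C n | n. n \<ge> 1} \<and>
    cons_Inf L {C n | n. n \<ge> 1} \<notin> finite_cons_ops L \<and>
    \<not> (\<forall>\<H>. \<H> \<noteq> {} \<and> \<H> \<subseteq> finite_cons_ops L \<longrightarrow> cons_Inf L \<H> \<in> finite_cons_ops L)"
proof -
  let ?H = "{C n | n. n \<ge> 1}"
  let ?D = "cons_Inf L ?H"
  have inj: "inj f" and ran: "range f = L"
    using assms(3) by (auto simp: bij_betw_def)
  have fL: "f n \<in> L" for n using ran by blast
  have fin: "C n \<in> finite_cons_ops L" if "n \<ge> 1" for n
    using that fL by (auto simp: assms(4,5) intro!: adjoin_if_finite)
  have ne: "?H \<noteq> {}" by blast
  have H: "?H \<subseteq> finite_cons_ops L" using fin by blast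
  then have "?H \<subseteq> general_cons_ops L" by (auto simp: finite_cons_ops_def)
  then have glb: "is_glb (general_cons_order L) ?D ?H"
    by (rule cons_Inf_is_glb[OF ne])
  have nfin: "?D \<notin> finite_cons_ops L"
  proof
    assume "?D \<in> finite_cons_ops L"
    \<comment> \<open>The union of all the \<open>B n\<close>: every \<open>C n\<close> fires on it,
      and starting at index 1 keeps \<open>f 0\<close> out.\<close>
    let ?X = "f ` {1..}"
    have X: "?X \<subseteq> L" using fL by blast
    have "f 0 \<in> C n ?X" if "n \<ge> 1" for n
    proof -
      have "B n \<subseteq> ?X" using that by (auto simp: assms(4))
      then show ?thesis using that X by (simp add: assms(5) adjoin_if_def)
    qed
    then have "f 0 \<in> ?D ?X" using X by (auto simp: cons_Inf_def)
    also have "?D ?X = (\<Union>F \<in> Fpow ?X. ?D F)"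
      using \<open>?D \<in> finite_cons_ops L\<close> X by (simp add: finite_cons_ops_def)
    finally obtain F where F: "F \<subseteq> ?X" "finite F" "f 0 \<in> ?D F"
      by (auto simp: Fpow_def)
    have "infinite ?X"
      using inj by (simp add: finite_image_iff inj_on_subset infinite_Ici)
    then have "\<not> ?X \<subseteq> F" using F(2) finite_subset by blast
    \<comment> \<open>Since \<open>f n\<close> belongs to \<open>B n\<close>, the test of this
      \<open>C n\<close> fails on F, so \<open>C n\<close> leaves F unchanged and \<open>f 0\<close>
      would have to lie in F already.\<close>
    then obtain n where n: "n \<ge> 1" "f n \<notin> F" by auto
    have FL: "F \<subseteq> L" using F(1) X by blast
    then have "f 0 \<in> C n F" using F(3) n(1) by (auto simp: cons_Inf_def)
    moreover have "f n \<in> B n" using n(1) by (simp add: assms(4))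
    ultimately have "f 0 \<in> F"
      using FL n by (auto simp: assms(5) adjoin_if_def split: if_splits)
    then have "f 0 \<in> ?X" using F(1) by blast
    then show False by (simp add: inj_image_mem_iff[OF inj])
  qed
  show ?thesis
  proof (intro conjI)
    show "\<forall>n\<ge>1. C n \<in> finite_cons_ops L" using fin by blast
    show "\<not> (\<forall>\<H>. \<H> \<noteq> {} \<and> \<H> \<subseteq> finite_cons_ops L \<longrightarrow> cons_Inf L \<H> \<in> finite_cons_ops L)"
    proof
      assume "\<forall>\<H>. \<H> \<noteq> {} \<and> \<H> \<subseteq> finite_cons_ops L \<longrightarrow> cons_Inf L \<H> \<in> finite_cons_ops L"
      from mp[OF spec[OF this] conjI[OF ne H]] nfin show False by contradiction
    qed
  qed (fact glb nfin)+
qed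

end
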